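(* $B_0(y,t,q)=1$, and for every $n\ge0$, \[ B_{n+1}(y,t,q)=(y+t)\,D_q\big[(1+yt)\,B_n(y,t,q)\big], \] where $D_q$ is the $q$-derivative with respect to $t$, i.e. the linear operator (in $t$, with $y,q$ treated as constants) sending $t^m$ to $[m]_q t^{m-1}$, with $[m]_q=(1-q^m)/(1-q)$.
   Context: A Ferrers diagram is a top- and left-justified array of unit cells with weakly decreasing row lengths (empty rows and columns allowed); its length is the number of rows plus the number of columns. For a Ferrers diagram $F$ with $k$ columns, the shifted diagram $\overline F$ is obtained by adding above $F$ $k$ new left-justified rows of lengths $1,2,\dots,k$ (top to bottom); the rightmost cell of an added row is a diagonal cell. The length of $\overline F$ is that of $F$. A type $B$ permutation tableau of length $n$ is a $0,1$-filling of such an $\overline F$ of length $n$ with (1) each column containing a $1$; (2) no $0$ having both a $1$ above it in its column and a $1$ to its left in its row; (3) no $0$ in a diagonal cell having a $1$ to its left in its row. $\mathrm{PT}_B(n)$ denotes the set of these. For $T$: $\operatorname{so}(T)$ is the number of $1$'s having a $1$ above them in the same column, $\operatorname{row}(T)$ the number of rows of $F$ (added rows excluded), $\operatorname{diag}(T)$ the number of $1$'s in diagonal cells. $B_n(y,t,q)=\sum_{T\in\mathrm{PT}_B(n)}y^{2\operatorname{row}(T)+\operatorname{diag}(T)}t^{\operatorname{diag}(T)}q^{\operatorname{so}(T)}$. *)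

theory Defs
  imports "HOL-Computational_Algebra.Polynomial" "HOL-Library.FuncSet"
begin

(* A Ferrers diagram is given by its number of columns together with the list of its row lengths
   (top to bottom).  The number of columns is recorded separately because empty columns are
   allowed; zeros in the list are empty rows. *)
datatype diagram = Diagram (ncols: nat) (row_lengths: "nat list")

definition ferrers :: "diagram \<Rightarrow> bool" where
  "ferrers F \<longleftrightarrow> sorted_wrt (\<ge>) (row_lengths F) \<and> (\<forall>l\<in>set (row_lengths F). l \<le> ncols F)"

definition nrows :: "diagram \<Rightarrow> nat" where
  "nrows F = length (row_lengths F)"

definition diagram_length :: "diagram \<Rightarrow> nat" where
  "diagram_length F = nrows F + ncols F"

definition shifted_row_lengths :: "diagram \<Rightarrow> nat list" where
  "shifted_row_lengths F = [1..<Suc (ncols F)] @ row_lengths F"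

(* The cells of the shifted diagram of F.  A cell is a pair (row, column), both counted from 0,
   rows from top to bottom and columns from left to right. *)
definition cells :: "diagram \<Rightarrow> (nat \<times> nat) set" where
  "cells F = {(i, j). i < length (shifted_row_lengths F) \<and> j < shifted_row_lengths F ! i}"

(* The added row with index i has length i + 1, so its rightmost cell is (i, i). *)
definition diagonal_cells :: "diagram \<Rightarrow> (nat \<times> nat) set" where
  "diagonal_cells F = {(i, i) | i. i < ncols F}"

definition ones :: "diagram \<Rightarrow> (nat \<times> nat \<Rightarrow> nat) \<Rightarrow> (nat \<times> nat) set" where
  "ones F T = {c \<in> cells F. T c = 1}"

definition zeros :: "diagram \<Rightarrow> (nat \<times> nat \<Rightarrow> nat) \<Rightarrow> (nat \<times> nat) set" where
  "zeros F T = {c \<in> cells F. T c = 0}"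

definition one_above :: "diagram \<Rightarrow> (nat \<times> nat \<Rightarrow> nat) \<Rightarrow> nat \<Rightarrow> nat \<Rightarrow> bool" where
  "one_above F T i j \<longleftrightarrow> (\<exists>i'<i. (i', j) \<in> ones F T)"

definition one_left :: "diagram \<Rightarrow> (nat \<times> nat \<Rightarrow> nat) \<Rightarrow> nat \<Rightarrow> nat \<Rightarrow> bool" where
  "one_left F T i j \<longleftrightarrow> (\<exists>j'<j. (i, j') \<in> ones F T)"

(* Fillings are extensional functions on the cells, so that each filling is counted once. *)
definition typeB_tableau :: "diagram \<Rightarrow> (nat \<times> nat \<Rightarrow> nat) \<Rightarrow> bool" where
  "typeB_tableau F T \<longleftrightarrow>
     ferrers F \<and> T \<in> cells F \<rightarrow>\<^sub>E {0, 1} \<and>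
     (\<forall>j<ncols F. \<exists>i. (i, j) \<in> ones F T) \<and>
     (\<forall>(i, j)\<in>zeros F T. \<not> (one_above F T i j \<and> one_left F T i j)) \<and>
     (\<forall>(i, j)\<in>zeros F T \<inter> diagonal_cells F. \<not> one_left F T i j)"

definition PT_B :: "nat \<Rightarrow> (diagram \<times> (nat \<times> nat \<Rightarrow> nat)) set" where
  "PT_B n = {(F, T). diagram_length F = n \<and> typeB_tableau F T}"

definition so_stat :: "diagram \<Rightarrow> (nat \<times> nat \<Rightarrow> nat) \<Rightarrow> nat" where
  "so_stat F T = card {(i, j) \<in> ones F T. one_above F T i j}"

definition diag_stat :: "diagram \<Rightarrow> (nat \<times> nat \<Rightarrow> nat) \<Rightarrow> nat" where
  "diag_stat F T = card (ones F T \<inter> diagonal_cells F)"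

(* The sum defining B_poly below ranges over a finite set. *)
lemma finite_PT_B: "finite (PT_B n)"
proof -
  let ?L = "{xs :: nat list. set xs \<subseteq> {..n} \<and> length xs \<le> n}"
  let ?D = "(\<lambda>(k, xs). Diagram k xs) ` ({..n} \<times> ?L)"
  have fin_cells: "finite (cells F)" for F
  proof -
    have "cells F = (SIGMA i:{..<length (shifted_row_lengths F)}. {..<shifted_row_lengths F ! i})"
      by (auto simp: cells_def)
    then show ?thesis by simp
  qed
  have "PT_B n \<subseteq> (SIGMA F:?D. cells F \<rightarrow>\<^sub>E {0, 1})"
  proof
    fix p assume "p \<in> PT_B n"
    then obtain F T where p: "p = (F, T)" and len: "diagram_length F = n"
      and tab: "typeB_tableau F T"
      by (auto simp: PT_B_def)
    obtain k xs where F: "F = Diagram k xs" by (cases F)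
    have "F \<in> ?D"
      using len tab by (force simp: F diagram_length_def nrows_def typeB_tableau_def ferrers_def)
    then show "p \<in> (SIGMA F:?D. cells F \<rightarrow>\<^sub>E {0, 1})"
      using tab by (auto simp: p typeB_tableau_def)
  qed
  moreover have "finite (SIGMA F:?D. cells F \<rightarrow>\<^sub>E {0, 1::nat})"
    using finite_lists_length_le[of "{..n}" n] by (intro finite_SigmaI finite_PiE fin_cells) auto
  ultimately show ?thesis by (rule finite_subset)
qed

(* Polynomials in y, q, t are elements of Z[y][q][t]: the innermost variable is y, the
   outermost is t. *)
definition var_y :: "int poly poly poly" where
  "var_y = [:[:[:0, 1:]:]:]"

definition var_q :: "int poly poly poly" where
  "var_q = [:[:0, 1:]:]"

definition var_t :: "int poly poly poly" where
  "var_t = [:0, 1:]"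

definition B_poly :: "nat \<Rightarrow> int poly poly poly" where
  "B_poly n = (\<Sum>(F, T)\<in>PT_B n.
     var_y ^ (2 * nrows F + diag_stat F T) * var_t ^ diag_stat F T * var_q ^ so_stat F T)"

(* Exact division in Z[y][q], see q_int_eq. *)
definition q_int :: "nat \<Rightarrow> int poly poly" where
  "q_int m = (1 - [:0, 1:] ^ m) div (1 - [:0, 1:])"

lemma q_int_eq: "q_int m * (1 - [:0, 1:]) = 1 - [:0, 1:] ^ m"
proof -
  have "1 - [:0, 1:] dvd 1 - ([:0, 1:] :: int poly poly) ^ m"
    by (metis dvd_triv_left one_diff_power_eq)
  then show ?thesis by (simp add: q_int_def)
qed

(* The term m = 0 is left out since [0]_q = 0. *)
definition q_deriv :: "int poly poly poly \<Rightarrow> int poly poly poly" where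
  "q_deriv p = (\<Sum>m = 1..degree p. monom (coeff p m * q_int m) (m - 1))"

lemma q_int_0: "q_int 0 = 0"
  by (simp add: q_int_def)

lemma coeff_q_deriv: "coeff (q_deriv p) m = coeff p (Suc m) * q_int (Suc m)"
proof -
  have "coeff (q_deriv p) m =
      (\<Sum>k = 1..degree p. if k = Suc m then coeff p (Suc m) * q_int (Suc m) else 0)"
    unfolding q_deriv_def coeff_sum by (intro sum.cong) auto
  also have "\<dots> = coeff p (Suc m) * q_int (Suc m)"
    by (auto simp: coeff_eq_0 not_le)
  finally show ?thesis .
qed

(* q_deriv is the linear operator over Z[y][q] with t^m |-> [m]_q t^(m - 1). *)
lemma q_deriv_add: "q_deriv (p + r) = q_deriv p + q_deriv r"
  by (rule poly_eqI) (simp add: coeff_q_deriv algebra_simps)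

lemma q_deriv_smult: "q_deriv (smult c p) = smult c (q_deriv p)"
  by (rule poly_eqI) (simp add: coeff_q_deriv algebra_simps)

lemma q_deriv_power: "q_deriv (var_t ^ m) = smult (q_int m) (var_t ^ (m - 1))"
proof -
  have t: "var_t ^ k = monom 1 k" for k
    by (simp add: var_t_def monom_altdef)
  show ?thesis
    by (rule poly_eqI, cases m) (auto simp: t coeff_q_deriv q_int_0 simp del: power_Suc)
qed

end

theory Submission
  imports Defs
begin

text \<open>
  A row is restricted if it contains a \<open>0\<close> that is diagonal or has a \<open>1\<close> above it; such a row
  can have no \<open>1\<close> further left.  A tableau of length \<open>n + 1\<close> arises uniquely from one of length \<open>n\<close>
  either by an empty last row, or by a new first column, whose \<open>1\<close>s are a nonempty set of cells
  chosen among its diagonal cell and the cells in unrestricted rows.  Marking unrestricted rows by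
  \<open>x\<close>, this gives for the generating function \<open>W\<^sub>n(x)\<close> the recursion
  \<open>(1 + qx - x) W\<^bsub>n+1\<^esub>(x) =
    x ((1 + qx - x) (y\<^sup>2 W\<^sub>n(x) + y t W\<^sub>n(1 + qx)) + W\<^sub>n(1 + qx) - W\<^sub>n(x))\<close>.
  At \<open>x = [m]\<close> we have \<open>1 + qx = [m + 1]\<close> and \<open>1 + qx - x = q\<^sup>m\<close>.  The shift of \<open>m\<close> is a
  \<open>q\<close>-derivative in \<open>t\<close>: by induction on \<open>n\<close>,
  \<open>[m] (W\<^sub>n([m + 1]) - W\<^sub>n([m])) = q\<^sup>m (y + t) D W\<^sub>n([m])\<close>.
  Substituting this into the recursion at \<open>m = 1\<close> gives the theorem.
\<close>

section \<open>Tableaux as sets of cells\<close>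

text \<open>Conditions (2) and (3) both forbid a 1 to the left of certain zeros. Collecting these
  zeros in one predicate turns the two conditions into the last clause of
  \<open>tableau_ones\<close>.\<close>

definition blocked :: "diagram \<Rightarrow> (nat \<times> nat) set \<Rightarrow> nat \<Rightarrow> nat \<Rightarrow> bool" where
  "blocked F X i j \<longleftrightarrow> (i, j) \<in> cells F \<and> (i, j) \<notin> X \<and>
     (i = j \<and> j < ncols F \<or> (\<exists>i'<i. (i', j) \<in> X))"

definition tableau_ones :: "diagram \<Rightarrow> (nat \<times> nat) set \<Rightarrow> bool" where
  "tableau_ones F X \<longleftrightarrow> ferrers F \<and> X \<subseteq> cells F \<and>
     (\<forall>j<ncols F. \<exists>i. (i, j) \<in> X) \<and>
     (\<forall>i j j'. blocked F X i j \<longrightarrow> j' < j \<longrightarrow> (i, j') \<notin> X)"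

definition tableaux :: "nat \<Rightarrow> (diagram \<times> (nat \<times> nat) set) set" where
  "tableaux n = {(F, X). diagram_length F = n \<and> tableau_ones F X}"

text \<open>These are the unrestricted rows. The bound is the number of rows of the shifted diagram,
  which equals its length; empty rows are included.\<close>

definition free_rows :: "diagram \<Rightarrow> (nat \<times> nat) set \<Rightarrow> nat set" where
  "free_rows F X = {i. i < diagram_length F \<and> (\<forall>j. \<not> blocked F X i j)}"

definition so_set :: "(nat \<times> nat) set \<Rightarrow> (nat \<times> nat) set" where
  "so_set X = {(i, j) \<in> X. \<exists>i'<i. (i', j) \<in> X}"

definition weight :: "diagram \<times> (nat \<times> nat) set \<Rightarrow> int poly poly poly" where
  "weight = (\<lambda>(F, X). var_y ^ (2 * nrows F + card (X \<inter> diagonal_cells F)) *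
     var_t ^ card (X \<inter> diagonal_cells F) * var_q ^ card (so_set X))"

text \<open>This is W_n(x) of the overview. The argument is an arbitrary ring element, since it is
  to be evaluated at 1 + qx and at q-integers.\<close>

definition free_rows_poly :: "nat \<Rightarrow> int poly poly poly \<Rightarrow> int poly poly poly" where
  "free_rows_poly n x = (\<Sum>(F, X)\<in>tableaux n. weight (F, X) * x ^ card (free_rows F X))"

section \<open>From fillings to sets of cells\<close>

lemma length_shifted_row_lengths: "length (shifted_row_lengths F) = diagram_length F"
  by (simp add: shifted_row_lengths_def diagram_length_def nrows_def)

lemma finite_cells: "finite (cells F)"
proof -
  have "cells F = (SIGMA i:{..<length (shifted_row_lengths F)}. {..<shifted_row_lengths F ! i})"
    by (auto simp: cells_def)
  then show ?thesis by simp
qed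

lemma finite_free_rows: "finite (free_rows F X)"
  by (simp add: free_rows_def)

lemma typeB_tableau_iff:
  assumes "T \<in> cells F \<rightarrow>\<^sub>E {0, 1}"
  shows "typeB_tableau F T \<longleftrightarrow> tableau_ones F (ones F T)"
proof -
  have zeros: "zeros F T = cells F - ones F T"
    using assms by (force simp: zeros_def ones_def PiE_iff)
  have sub: "ones F T \<subseteq> cells F"
    by (auto simp: ones_def)
  have diagonal: "(i, j) \<in> diagonal_cells F \<longleftrightarrow> i = j \<and> j < ncols F" for i j
    by (auto simp: diagonal_cells_def)
  have "(\<forall>(i, j)\<in>zeros F T. \<not> (one_above F T i j \<and> one_left F T i j)) \<and>
      (\<forall>(i, j)\<in>zeros F T \<inter> diagonal_cells F. \<not> one_left F T i j) \<longleftrightarrow>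
      (\<forall>i j. blocked F (ones F T) i j \<longrightarrow> \<not> one_left F T i j)"
    unfolding blocked_def zeros one_above_def Ball_def split_paired_All case_prod_conv Diff_iff
      Int_iff diagonal by blast
  also have "\<dots> \<longleftrightarrow> (\<forall>i j j'. blocked F (ones F T) i j \<longrightarrow> j' < j \<longrightarrow> (i, j') \<notin> ones F T)"
    unfolding one_left_def by blast
  finally show ?thesis
    unfolding typeB_tableau_def tableau_ones_def using assms sub by blast
qed

lemma bij_betw_ones: "bij_betw (\<lambda>(F, T). (F, ones F T)) (PT_B n) (tableaux n)"
proof (rule bij_betwI')
  show "(\<lambda>(F, T). (F, ones F T)) p \<in> tableaux n" if "p \<in> PT_B n" for p
    using that typeB_tableau_iff by (auto simp: PT_B_def tableaux_def typeB_tableau_def)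
next
  fix p p' assume p: "p \<in> PT_B n" "p' \<in> PT_B n"
  obtain F T F' T' where e: "p = (F, T)" "p' = (F', T')" by (cases p, cases p')
  have T: "T \<in> cells F \<rightarrow>\<^sub>E {0, 1}" "T' \<in> cells F' \<rightarrow>\<^sub>E {0, 1}"
    using p by (auto simp: e PT_B_def typeB_tableau_def)
  have "T = T'" if "F = F'" "ones F T = ones F T'"
  proof (rule PiE_ext)
    show "T \<in> cells F \<rightarrow>\<^sub>E {0, 1}" "T' \<in> cells F \<rightarrow>\<^sub>E {0, 1}" using T that by auto
    fix c assume c: "c \<in> cells F"
    then have "T c \<in> {0, 1}" "T' c \<in> {0, 1}" using T that by (auto simp: PiE_iff)
    moreover have "T c = 1 \<longleftrightarrow> T' c = 1" using that c by (auto simp: ones_def)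
    ultimately show "T c = T' c" by auto
  qed
  then show "((\<lambda>(F, T). (F, ones F T)) p = (\<lambda>(F, T). (F, ones F T)) p') = (p = p')"
    by (auto simp: e)
next
  fix r assume r: "r \<in> tableaux n"
  obtain F X where e: "r = (F, X)" by (cases r)
  define T where "T = (\<lambda>c\<in>cells F. if c \<in> X then 1 else 0 :: nat)"
  have T: "T \<in> cells F \<rightarrow>\<^sub>E {0, 1}" by (auto simp: T_def)
  have "ones F T = X" using r by (auto simp: ones_def T_def e tableaux_def tableau_ones_def)
  then show "\<exists>p\<in>PT_B n. r = (\<lambda>(F, T). (F, ones F T)) p"
    using r typeB_tableau_iff[OF T] by (auto simp: e tableaux_def PT_B_def intro!: bexI[of _ "(F, T)"])
qed

lemma finite_tableaux: "finite (tableaux n)"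
  using bij_betw_finite[OF bij_betw_ones] finite_PT_B by blast

lemma B_poly_eq_free_rows_poly: "B_poly n = free_rows_poly n 1"
proof -
  have "free_rows_poly n 1 = (\<Sum>p\<in>tableaux n. weight p)"
    by (simp add: free_rows_poly_def case_prod_beta)
  also have "\<dots> = (\<Sum>p\<in>PT_B n. weight ((\<lambda>(F, T). (F, ones F T)) p))"
    by (rule sum.reindex_bij_betw[OF bij_betw_ones, symmetric])
  also have "\<dots> = B_poly n"
    unfolding B_poly_def
    by (intro sum.cong refl)
      (auto simp: weight_def diag_stat_def so_stat_def so_set_def one_above_def)
  finally show ?thesis by simp
qed

section \<open>Adding an empty row or a first column\<close>

fun add_row :: "diagram \<times> (nat \<times> nat) set \<Rightarrow> diagram \<times> (nat \<times> nat) set" where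
  "add_row (Diagram k ls, X) = (Diagram k (ls @ [0]), X)"

fun add_col_diagram :: "diagram \<Rightarrow> diagram" where
  "add_col_diagram (Diagram k ls) = Diagram (Suc k) (map Suc ls)"

definition add_col_ones :: "nat set \<Rightarrow> (nat \<times> nat) set \<Rightarrow> (nat \<times> nat) set" where
  "add_col_ones A X = (\<lambda>i. (i, 0)) ` A \<union> map_prod Suc Suc ` X"

section \<open>Prepending a column\<close>

lemma mem_add_col_ones [simp]:
  "(i, 0) \<in> add_col_ones A X \<longleftrightarrow> i \<in> A"
  "(0, Suc j) \<notin> add_col_ones A X"
  "(Suc i, Suc j) \<in> add_col_ones A X \<longleftrightarrow> (i, j) \<in> X"
  by (auto simp: add_col_ones_def)

text \<open>The added rows of lengths 1, ..., k become those of lengths 2, ..., k + 1, below a new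
  top row of length 1. So the new column meets every row, and each old cell moves one step down and
  one step right.\<close>

lemma shifted_add_col: "shifted_row_lengths (add_col_diagram F) = 1 # map Suc (shifted_row_lengths F)"
proof (cases F)
  case (Diagram k ls)
  have "[1..<Suc (Suc k)] = 1 # map Suc [1..<Suc k]"
    by (simp only: map_Suc_upt) (simp add: upt_conv_Cons)
  then show ?thesis by (simp add: Diagram shifted_row_lengths_def del: upt_Suc)
qed

lemma mem_cells_add_col [simp]:
  "(i, 0) \<in> cells (add_col_diagram F) \<longleftrightarrow> i \<le> diagram_length F"
  "(0, Suc j) \<notin> cells (add_col_diagram F)"
  "(Suc i, Suc j) \<in> cells (add_col_diagram F) \<longleftrightarrow> (i, j) \<in> cells F"
  by (cases i; auto simp: cells_def shifted_add_col length_shifted_row_lengths)+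

lemma add_col_diagram_simps [simp]:
  "ncols (add_col_diagram F) = Suc (ncols F)"
  "nrows (add_col_diagram F) = nrows F"
  "diagram_length (add_col_diagram F) = Suc (diagram_length F)"
  "ferrers (add_col_diagram F) \<longleftrightarrow> ferrers F"
  by (cases F; auto simp: diagram_length_def nrows_def ferrers_def sorted_wrt_map)+

lemma blocked_add_col [simp]:
  "blocked (add_col_diagram F) (add_col_ones A X) (Suc i) (Suc j) \<longleftrightarrow> blocked F X i j"
  "\<not> blocked (add_col_diagram F) (add_col_ones A X) 0 (Suc j)"
  "blocked (add_col_diagram F) (add_col_ones A X) 0 0 \<longleftrightarrow> 0 \<notin> A"
  "blocked (add_col_diagram F) (add_col_ones A X) (Suc i) 0 \<longleftrightarrow>
     i < diagram_length F \<and> Suc i \<notin> A \<and> (\<exists>a\<le>i. a \<in> A)"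
proof -
  have "(\<exists>i'<Suc i. (i', Suc j) \<in> add_col_ones A X) \<longleftrightarrow> (\<exists>i'<i. (i', j) \<in> X)"
    by (metis Suc_less_eq mem_add_col_ones(2,3) not0_implies_Suc)
  then show "blocked (add_col_diagram F) (add_col_ones A X) (Suc i) (Suc j) \<longleftrightarrow> blocked F X i j"
    by (simp add: blocked_def)
qed (auto simp: blocked_def less_Suc_eq_le)

lemma all_nat_split: "(\<forall>i. P i) \<longleftrightarrow> P 0 \<and> (\<forall>i. P (Suc i))"
  by (metis not0_implies_Suc)

lemma add_col_ones_subset_iff:
  "add_col_ones A X \<subseteq> cells (add_col_diagram F) \<longleftrightarrow> A \<subseteq> {..diagram_length F} \<and> X \<subseteq> cells F"
proof -
  have "add_col_ones A X \<subseteq> cells (add_col_diagram F) \<longleftrightarrow>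
      (\<forall>i\<in>A. (i, 0) \<in> cells (add_col_diagram F)) \<and>
      (\<forall>c\<in>X. (Suc (fst c), Suc (snd c)) \<in> cells (add_col_diagram F))"
    by (auto simp: add_col_ones_def image_subset_iff map_prod_def split_beta)
  then show ?thesis by auto
qed

text \<open>Zeros in the new column have nothing to their left, and the shift preserves
  \<open>blocked\<close>. The only new demand on the 1s of the new column is that no blocked cell
  lies to their right, i.e. that their old rows are free. Row 0 has no further cell, so its diagonal
  cell can be chosen at will.\<close>

lemma tableau_ones_add_col:
  "tableau_ones (add_col_diagram F) (add_col_ones A X) \<longleftrightarrow>
     tableau_ones F X \<and> A \<noteq> {} \<and> A \<subseteq> insert 0 (Suc ` free_rows F X)"
  (is "?L \<longleftrightarrow> ?R")
proof
  assume L: ?L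
  have nb: "(i, j') \<notin> add_col_ones A X"
    if "blocked (add_col_diagram F) (add_col_ones A X) i j" "j' < j" for i j j'
    using L that by (auto simp: tableau_ones_def)
  have col: "\<exists>i. (i, j) \<in> add_col_ones A X" if "j < Suc (ncols F)" for j
    using L that by (auto simp: tableau_ones_def)
  have "A \<noteq> {}" using col[of 0] by auto
  moreover have "\<exists>i. (i, j) \<in> X" if "j < ncols F" for j
    using col[of "Suc j"] that by (metis Suc_less_eq mem_add_col_ones(2,3) not0_implies_Suc)
  moreover have "(i, j') \<notin> X" if "blocked F X i j" "j' < j" for i j j'
    using nb[of "Suc i" "Suc j" "Suc j'"] that by simp
  moreover have "A \<subseteq> insert 0 (Suc ` free_rows F X)"
  proof
    fix a assume a: "a \<in> A"
    show "a \<in> insert 0 (Suc ` free_rows F X)"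
    proof (cases a)
      case (Suc i)
      have "i < diagram_length F"
        using L a Suc by (auto simp: tableau_ones_def add_col_ones_subset_iff)
      moreover have "\<not> blocked F X i j" for j
        using nb[of "Suc i" "Suc j" 0] a Suc by auto
      ultimately show ?thesis by (auto simp: Suc free_rows_def)
    qed simp
  qed
  ultimately show ?R using L by (auto simp: tableau_ones_def add_col_ones_subset_iff)
next
  assume R: ?R
  have "(i, j') \<notin> add_col_ones A X"
    if b: "blocked (add_col_diagram F) (add_col_ones A X) i j" and j: "j' < j" for i j j'
  proof -
    obtain j0 where j0: "j = Suc j0" using j by (cases j) auto
    then obtain i0 where i0: "i = Suc i0" using b by (cases i) auto
    have b': "blocked F X i0 j0" using b by (simp add: i0 j0)
    show ?thesis
    proof (cases j')
      case 0
      then show ?thesis using R b' by (auto simp: i0 free_rows_def)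
    next
      case (Suc k)
      then show ?thesis using R b' j by (auto simp: i0 j0 tableau_ones_def)
    qed
  qed
  moreover have "\<exists>i. (i, j) \<in> add_col_ones A X" if "j < Suc (ncols F)" for j
  proof (cases j)
    case 0
    then show ?thesis using R by auto
  next
    case (Suc k)
    then have "k < ncols F" using that by simp
    then obtain i where "(i, k) \<in> X" using R unfolding tableau_ones_def by blast
    then have "(Suc i, j) \<in> add_col_ones A X" by (simp add: Suc)
    then show ?thesis ..
  qed
  moreover have "A \<subseteq> {..diagram_length F}" using R by (auto simp: free_rows_def)
  ultimately show ?L
    using R unfolding tableau_ones_def add_col_ones_subset_iff by simp
qed

text \<open>A row with a 0 in the new column stays free only if no 1 of that column lies above it.
  Here \<open>i\<close> is an old index, so \<open>i < a\<close> puts the new row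
  \<open>Suc i\<close> at or above row \<open>a\<close>. Row 0 is free only with a 1, its cell being
  diagonal.\<close>

lemma free_rows_add_col:
  assumes "A \<subseteq> insert 0 (Suc ` free_rows F X)"
  shows "free_rows (add_col_diagram F) (add_col_ones A X) =
    A \<union> Suc ` {i \<in> free_rows F X. \<forall>a\<in>A. i < a}"
proof (rule set_eqI)
  fix i
  show "i \<in> free_rows (add_col_diagram F) (add_col_ones A X) \<longleftrightarrow>
    i \<in> A \<union> Suc ` {i \<in> free_rows F X. \<forall>a\<in>A. i < a}"
  proof (cases i)
    case 0
    have "(\<forall>j. \<not> blocked (add_col_diagram F) (add_col_ones A X) 0 j) \<longleftrightarrow> 0 \<in> A"
      by (subst all_nat_split) simp
    then show ?thesis by (auto simp: 0 free_rows_def)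
  next
    case (Suc k)
    have "(\<forall>j. \<not> blocked (add_col_diagram F) (add_col_ones A X) (Suc k) j) \<longleftrightarrow>
        \<not> (k < diagram_length F \<and> Suc k \<notin> A \<and> (\<exists>a\<le>k. a \<in> A)) \<and> (\<forall>j. \<not> blocked F X k j)"
      by (subst all_nat_split) simp
    then have "i \<in> free_rows (add_col_diagram F) (add_col_ones A X) \<longleftrightarrow>
        k \<in> free_rows F X \<and> (Suc k \<in> A \<or> (\<forall>a\<in>A. k < a))"
      by (auto simp: free_rows_def Suc not_le)
    then show ?thesis using assms by (auto simp: Suc)
  qed
qed

lemma so_set_add_col: "so_set (add_col_ones A X) = (\<lambda>i. (i, 0)) ` {i\<in>A. \<exists>a\<in>A. a < i} \<union> map_prod Suc Suc ` so_set X"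
proof (intro set_eqI)
  fix c :: "nat \<times> nat"
  obtain i j where c: "c = (i, j)" by (cases c)
  consider "j = 0" | k where "i = 0" "j = Suc k" | l k where "i = Suc l" "j = Suc k"
    by (metis not0_implies_Suc)
  then show "c \<in> so_set (add_col_ones A X) \<longleftrightarrow>
    c \<in> (\<lambda>i. (i, 0)) ` {i\<in>A. \<exists>a\<in>A. a < i} \<union> map_prod Suc Suc ` so_set X"
  proof cases
    case 3
    have "(\<exists>i'<Suc l. (i', Suc k) \<in> add_col_ones A X) \<longleftrightarrow> (\<exists>i'<l. (i', k) \<in> X)"
      by (metis Suc_less_eq mem_add_col_ones(2,3) not0_implies_Suc)
    with 3 show ?thesis by (auto simp: c so_set_def)
  qed (auto simp: c so_set_def)
qed

lemma card_so_set_add_col: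
  assumes "finite A" "A \<noteq> {}" "finite X"
  shows "card (so_set (add_col_ones A X)) = card A - 1 + card (so_set X)"
proof -
  \<comment> \<open>Only the topmost 1 of the new column has no 1 above it.\<close>
  have "{i\<in>A. \<exists>a\<in>A. a < i} = A - {Min A}"
  proof (intro set_eqI iffI)
    fix i assume "i \<in> A - {Min A}"
    then show "i \<in> {i\<in>A. \<exists>a\<in>A. a < i}"
      using Min_in[OF assms(1,2)] Min_le[OF assms(1), of i] by (auto simp: le_less)
  next
    fix i assume "i \<in> {i\<in>A. \<exists>a\<in>A. a < i}"
    then show "i \<in> A - {Min A}" using Min_le[OF assms(1)] by (auto simp: leD)
  qed
  moreover have "finite (so_set X)"
    using assms(3) by (rule rev_finite_subset) (auto simp: so_set_def)
  moreover have "card (so_set (add_col_ones A X)) =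
      card ((\<lambda>i. (i, 0::nat)) ` {i\<in>A. \<exists>a\<in>A. a < i}) + card (map_prod Suc Suc ` so_set X)"
    unfolding so_set_add_col using assms(1) \<open>finite (so_set X)\<close>
    by (intro card_Un_disjoint) auto
  moreover have "card ((\<lambda>i. (i, 0::nat)) ` {i\<in>A. \<exists>a\<in>A. a < i}) = card {i\<in>A. \<exists>a\<in>A. a < i}"
    by (rule card_image) (auto simp: inj_on_def)
  moreover have "card (map_prod Suc Suc ` so_set X) = card (so_set X)"
    by (rule card_image) (auto simp: inj_on_def)
  ultimately show ?thesis
    using assms by simp
qed

lemma card_diagonal_add_col:
  assumes "finite X"
  shows "card (add_col_ones A X \<inter> diagonal_cells (add_col_diagram F)) =
    card (X \<inter> diagonal_cells F) + (if 0 \<in> A then 1 else 0)"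
proof -
  have "add_col_ones A X \<inter> diagonal_cells (add_col_diagram F) =
     (if 0 \<in> A then {(0, 0)} else {}) \<union> map_prod Suc Suc ` (X \<inter> diagonal_cells F)"
  proof (intro set_eqI)
    fix c :: "nat \<times> nat"
    obtain i j where c: "c = (i, j)" by (cases c)
    show "c \<in> add_col_ones A X \<inter> diagonal_cells (add_col_diagram F) \<longleftrightarrow>
      c \<in> (if 0 \<in> A then {(0, 0)} else {}) \<union> map_prod Suc Suc ` (X \<inter> diagonal_cells F)"
      by (cases i; cases j) (auto simp: c diagonal_cells_def)
  qed
  moreover have "finite (map_prod Suc Suc ` (X \<inter> diagonal_cells F))"
    using assms by simp
  moreover have "card (map_prod Suc Suc ` (X \<inter> diagonal_cells F)) = card (X \<inter> diagonal_cells F)"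
    by (rule card_image) (auto simp: inj_on_def)
  ultimately show ?thesis
    by (auto simp: card_insert_if)
qed

text \<open>A diagonal 1 contributes both y and t, because \<open>diag\<close> occurs in both
  exponents; each 1 below the topmost one contributes q.\<close>

lemma weight_add_col:
  assumes "finite A" "A \<noteq> {}" "finite X"
  shows "weight (add_col_diagram F, add_col_ones A X) =
    weight (F, X) * (if 0 \<in> A then var_y * var_t else 1) * var_q ^ (card A - 1)"
  using assms by (simp add: weight_def card_so_set_add_col card_diagonal_add_col power_add algebra_simps)

section \<open>Appending an empty row\<close>

lemma add_row_facts:
  assumes "add_row (F, X) = (F', X')"
  shows "X' = X" "ncols F' = ncols F" "nrows F' = Suc (nrows F)"
    "diagram_length F' = Suc (diagram_length F)" "cells F' = cells F" "ferrers F' \<longleftrightarrow> ferrers F"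
proof -
  obtain k ls where F: "F = Diagram k ls" by (cases F)
  have F': "F' = Diagram k (ls @ [0])" and "X' = X" using assms by (auto simp: F)
  then show "X' = X" "ncols F' = ncols F" "nrows F' = Suc (nrows F)"
    "diagram_length F' = Suc (diagram_length F)" "ferrers F' \<longleftrightarrow> ferrers F"
    by (auto simp: F diagram_length_def nrows_def ferrers_def sorted_wrt_append)
  have "shifted_row_lengths F' = shifted_row_lengths F @ [0]"
    by (simp add: F F' shifted_row_lengths_def)
  then show "cells F' = cells F"
    by (auto simp: cells_def nth_append less_Suc_eq split: if_splits)
qed

lemma tableau_ones_add_row:
  assumes "add_row (F, X) = (F', X')"
  shows "tableau_ones F' X' \<longleftrightarrow> tableau_ones F X"
  by (simp add: tableau_ones_def blocked_def add_row_facts[OF assms])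

lemma weight_add_row: "weight (add_row (F, X)) = var_y\<^sup>2 * weight (F, X)"
proof -
  obtain F' X' where e: "add_row (F, X) = (F', X')" by (cases "add_row (F, X)")
  show ?thesis
    by (simp add: e weight_def add_row_facts[OF e] diagonal_cells_def power_add power2_eq_square)
qed

lemma card_free_rows_add_row:
  assumes "add_row (F, X) = (F', X')"
  shows "card (free_rows F' X') = Suc (card (free_rows F X))"
proof -
  \<comment> \<open>The new row has no cells, hence no blocked one.\<close>
  have "free_rows F' X' = insert (diagram_length F) (free_rows F X)"
    by (auto simp: free_rows_def blocked_def add_row_facts[OF assms] less_Suc_eq)
      (auto simp: cells_def length_shifted_row_lengths)
  then show ?thesis
    by (simp add: finite_free_rows) (simp add: free_rows_def)
qed

text \<open>The column is given by the rows of its \<open>1\<close>s; row \<open>0\<close> is its diagonal cell, and row \<open>i\<close> of the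
  old shifted diagram becomes row \<open>i + 1\<close>.\<close>

definition columns :: "diagram \<times> (nat \<times> nat) set \<Rightarrow> nat set set" where
  "columns = (\<lambda>(F, X). {A. A \<noteq> {} \<and> A \<subseteq> insert 0 (Suc ` free_rows F X)})"

definition add_col :: "(diagram \<times> (nat \<times> nat) set) \<times> nat set \<Rightarrow> diagram \<times> (nat \<times> nat) set" where
  "add_col = (\<lambda>((F, X), A). (add_col_diagram F, add_col_ones A X))"

section \<open>Unique decomposition of a tableau of length n + 1\<close>

lemma inj_add_row: "inj add_row"
proof (rule injI)
  fix p p' assume e: "add_row p = add_row p'"
  obtain k ls X k' ls' X' where "p = (Diagram k ls, X)" "p' = (Diagram k' ls', X')"
    by (metis add_row.cases)
  with e show "p = p'" by simp
qed

lemma inj_add_col: "inj add_col"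
proof (rule injI)
  fix r r' assume e: "add_col r = add_col r'"
  obtain k ls X A k' ls' X' A'
    where r: "r = ((Diagram k ls, X), A)" "r' = ((Diagram k' ls', X'), A')"
    by (metis surj_pair diagram.exhaust)
  have o: "add_col_ones A X = add_col_ones A' X'" and "k = k'" "map Suc ls = map Suc ls'"
    using e by (auto simp: r add_col_def)
  moreover have "ls = ls'" using \<open>map Suc ls = map Suc ls'\<close> by (simp add: inj_map_eq_map)
  moreover have "A = A'"
    using o mem_add_col_ones(1) by blast
  moreover have "X = X'"
    using o by (metis mem_add_col_ones(3) subrelI subset_antisym)
  ultimately show "r = r'" by (simp add: r)
qed

text \<open>The last row of the diagram is empty in the first case and no row is empty in the second.\<close>

lemma tableaux_Suc:
  "tableaux (Suc n) = add_row ` tableaux n \<union> add_col ` Sigma (tableaux n) columns"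
proof (intro set_eqI iffI)
  fix r assume r: "r \<in> tableaux (Suc n)"
  obtain k ls X where e: "r = (Diagram k ls, X)" by (metis surj_pair diagram.exhaust)
  have len: "length ls + k = Suc n" and tab: "tableau_ones (Diagram k ls) X"
    using r by (auto simp: e tableaux_def diagram_length_def nrows_def)
  have fer: "ferrers (Diagram k ls)" using tab by (simp add: tableau_ones_def)
  show "r \<in> add_row ` tableaux n \<union> add_col ` Sigma (tableaux n) columns"
  proof (cases "0 \<in> set ls")
    case True
    then obtain ls0 l where ls: "ls = ls0 @ [l]" by (metis empty_iff empty_set rev_exhaust)
    \<comment> \<open>Row lengths decrease weakly, so an empty row forces the last row to be
      empty.\<close>
    have "l = 0" using fer True by (force simp: ls ferrers_def sorted_wrt_append)
    then have a: "add_row (Diagram k ls0, X) = (Diagram k ls, X)" by (simp add: ls)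
    have "(Diagram k ls0, X) \<in> tableaux n"
      using tab len tableau_ones_add_row[OF a]
      by (simp add: tableaux_def diagram_length_def nrows_def ls)
    with a show ?thesis unfolding e by (metis UnI1 imageI)
  next
    case False
    \<comment> \<open>The length is positive, so without columns there would be a row, and it would
      be empty.\<close>
    have "k \<noteq> 0"
    proof
      assume "k = 0"
      then have "ls \<noteq> []" "\<forall>l\<in>set ls. l = 0" using len fer by (auto simp: ferrers_def)
      then show False using False by (metis list.set_intros(1) neq_Nil_conv)
    qed
    then obtain k0 where k: "k = Suc k0" by (cases k) auto
    define ls0 where "ls0 = map (\<lambda>l. l - 1) ls"
    have ls: "ls = map Suc ls0"
      unfolding ls0_def map_map using False by (intro map_idI[symmetric]) (metis Suc_pred' comp_apply neq0_conv)
    define F where "F = Diagram k0 ls0"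
    define A where "A = {i. (i, 0) \<in> X}"
    define Y where "Y = {(i, j). (Suc i, Suc j) \<in> X}"
    have F: "Diagram k ls = add_col_diagram F" by (simp add: F_def k ls)
    have sub: "X \<subseteq> cells (add_col_diagram F)" using tab by (simp add: tableau_ones_def F)
    \<comment> \<open>Row 0 of the shifted diagram has length 1, so \<open>X\<close> contains no
      cell \<open>(0, Suc j)\<close> and consists of its first column and a shifted set.\<close>
    have X: "X = add_col_ones A Y"
    proof (intro set_eqI)
      fix c :: "nat \<times> nat"
      obtain i j where c: "c = (i, j)" by (cases c)
      show "c \<in> X \<longleftrightarrow> c \<in> add_col_ones A Y"
        using sub by (cases i; cases j) (auto simp: c A_def Y_def)
    qed
    have "tableau_ones F Y \<and> A \<noteq> {} \<and> A \<subseteq> insert 0 (Suc ` free_rows F Y)"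
      using tab unfolding F X tableau_ones_add_col .
    moreover have "diagram_length F = n" using len by (simp add: F_def diagram_length_def nrows_def k ls)
    ultimately have "((F, Y), A) \<in> Sigma (tableaux n) columns"
      by (auto simp: tableaux_def columns_def)
    moreover have "r = add_col ((F, Y), A)" by (simp add: e F X[symmetric] add_col_def)
    ultimately show ?thesis by blast
  qed
next
  fix r assume "r \<in> add_row ` tableaux n \<union> add_col ` Sigma (tableaux n) columns"
  then consider F X where "(F, X) \<in> tableaux n" "r = add_row (F, X)"
    | F X A where "(F, X) \<in> tableaux n" "A \<in> columns (F, X)" "r = add_col ((F, X), A)"
    by auto
  then show "r \<in> tableaux (Suc n)"
  proof cases
    case 1
    obtain F' X' where a: "add_row (F, X) = (F', X')" by (cases "add_row (F, X)")
    show ?thesis using 1 tableau_ones_add_row[OF a] add_row_facts(4)[OF a]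
      by (simp add: a tableaux_def)
  next
    case 2
    then show ?thesis
      by (auto simp: add_col_def tableaux_def columns_def tableau_ones_add_col)
  qed
qed

lemma add_row_neq_add_col: "add_row p \<noteq> add_col r"
proof -
  obtain k ls X k' ls' X' A
    where "p = (Diagram k ls, X)" "r = ((Diagram k' ls', X'), A)"
    by (metis surj_pair diagram.exhaust)
  moreover have "ls @ [0] \<noteq> map Suc ls'"
    by (metis in_set_conv_decomp list.set_map imageE nat.distinct(1))
  ultimately show ?thesis by (auto simp: add_col_def)
qed

section \<open>Counting by unrestricted rows\<close>

lemma sum_Pow_power_card:
  fixes z :: "'a::comm_ring_1"
  assumes "finite U"
  shows "(\<Sum>B\<in>Pow U. z ^ card B) = (1 + z) ^ card U"
  using prod_add[OF assms, of "\<lambda>_. z" "\<lambda>_. 1"] by (simp add: add.commute)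

text \<open>This counts the columns with a 0 in the diagonal cell: \<open>B\<close> is the set of
  rows with a 1, and the exponent of \<open>x\<close> counts the rows that stay free. The sum is a
  geometric one with ratio terms 1 + qx and x; the factor on the left avoids a division. The
  induction adds a new smallest element, i.e. a new topmost free row.\<close>

lemma sum_nonempty_subsets:
  fixes q x :: "'a::comm_ring_1" and U :: "nat set"
  assumes "finite U"
  shows "(1 + q * x - x) *
      (\<Sum>B\<in>Pow U - {{}}. q ^ (card B - 1) * x ^ card (B \<union> {i\<in>U. \<forall>b\<in>B. i \<le> b})) =
    x * ((1 + q * x) ^ card U - x ^ card U)"
  using assms
proof (induction U rule: finite_linorder_min_induct)
  case empty
  then show ?case by simp
next
  case (insert a U)
  let ?g = "\<lambda>U B. q ^ (card B - 1) * x ^ card (B \<union> {i\<in>U. \<forall>b\<in>B. i \<le> b})"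
  have a: "a \<notin> U" using insert by auto
  have fin: "finite B" if "B \<subseteq> U" for B using that insert(1) finite_subset by blast
  have "Pow (insert a U) - {{}} = (Pow U - {{}}) \<union> insert a ` Pow U"
    by (auto simp: Pow_insert)
  then have "sum (?g (insert a U)) (Pow (insert a U) - {{}}) =
      sum (?g (insert a U)) (Pow U - {{}}) + sum (?g (insert a U)) (insert a ` Pow U)"
    using insert(1) a by (simp only:) (rule sum.union_disjoint, auto)
  \<comment> \<open>If \<open>a\<close> is not chosen, its row lies above all chosen rows and stays
    free, which gives one factor \<open>x\<close>.\<close>
  also have "sum (?g (insert a U)) (Pow U - {{}}) = x * sum (?g U) (Pow U - {{}})"
    unfolding sum_distrib_left
  proof (rule sum.cong[OF refl])
    fix B assume B: "B \<in> Pow U - {{}}"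
    have "B \<union> {i\<in>insert a U. \<forall>b\<in>B. i \<le> b} = insert a (B \<union> {i\<in>U. \<forall>b\<in>B. i \<le> b})"
      using B insert(2) by (auto intro: less_imp_le)
    moreover have "a \<notin> B \<union> {i\<in>U. \<forall>b\<in>B. i \<le> b}" using a B by auto
    ultimately show "?g (insert a U) B = x * ?g U B"
      using B fin insert(1) by simp
  qed
  also have "sum (?g (insert a U)) (insert a ` Pow U) = sum (?g (insert a U) \<circ> insert a) (Pow U)"
    by (rule sum.reindex) (use a in \<open>auto simp: inj_on_def\<close>)
  \<comment> \<open>If \<open>a\<close> is chosen, all other rows lie below it, so exactly the
    chosen rows stay free. The topmost 1 carries no \<open>q\<close>.\<close>
  also have "\<dots> = (\<Sum>B\<in>Pow U. x * (q * x) ^ card B)"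
  proof (rule sum.cong[OF refl])
    fix B assume B: "B \<in> Pow U"
    have "insert a B \<union> {i\<in>insert a U. \<forall>b\<in>insert a B. i \<le> b} = insert a B"
      using insert(2) by auto
    moreover have "card (insert a B) = Suc (card B)" using B a fin by (intro card_insert_disjoint) auto
    ultimately show "(?g (insert a U) \<circ> insert a) B = x * (q * x) ^ card B"
      by (simp add: power_mult_distrib)
  qed
  also have "\<dots> = x * (1 + q * x) ^ card U"
    by (simp add: sum_Pow_power_card[OF insert(1)] flip: sum_distrib_left)
  finally have S: "sum (?g (insert a U)) (Pow (insert a U) - {{}}) =
      x * sum (?g U) (Pow U - {{}}) + x * (1 + q * x) ^ card U" .
  have "(1 + q * x - x) * sum (?g (insert a U)) (Pow (insert a U) - {{}}) =
      x * ((1 + q * x - x) * sum (?g U) (Pow U - {{}})) + x * ((1 + q * x - x) * (1 + q * x) ^ card U)"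
    unfolding S by (simp add: algebra_simps)
  also have "\<dots> = x * ((1 + q * x) ^ card (insert a U) - x ^ card (insert a U))"
    unfolding insert.IH using insert(1) a by (simp add: algebra_simps)
  finally show ?case .
qed

text \<open>The columns are split by their diagonal cell. A 1 there (\<open>?D\<close>, weight
  \<open>z\<close>) lies above all other rows, so only rows with a 1 stay free and the binomial
  theorem applies; a 0 there (\<open>?E\<close>) leads to the previous lemma.\<close>

lemma sum_columns:
  fixes q x z :: "'a::comm_ring_1" and U :: "nat set"
  assumes "finite U"
  shows "(1 + q * x - x) *
      (\<Sum>A | A \<noteq> {} \<and> A \<subseteq> insert 0 (Suc ` U).
        (if 0 \<in> A then z else 1) * q ^ (card A - 1) * x ^ card (A \<union> Suc ` {i\<in>U. \<forall>a\<in>A. i < a})) =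
    x * ((1 + q * x - x) * z * (1 + q * x) ^ card U + (1 + q * x) ^ card U - x ^ card U)"
proof -
  let ?g = "\<lambda>A. (if 0 \<in> A then z else 1) * q ^ (card A - 1) * x ^ card (A \<union> Suc ` {i\<in>U. \<forall>a\<in>A. i < a})"
  have fin: "finite B" if "B \<subseteq> U" for B using that assms finite_subset by blast
  let ?C = "{A. A \<noteq> {} \<and> A \<subseteq> insert 0 (Suc ` U)}"
  let ?D = "(\<lambda>B. insert 0 (Suc ` B)) ` Pow U" and ?E = "(`) Suc ` (Pow U - {{}})"
  have C: "?C = ?D \<union> ?E"
  proof -
    have "?C = Pow (insert 0 (Suc ` U)) - {{}}" by blast
    also have "\<dots> = insert 0 ` Pow (Suc ` U) \<union> (Pow (Suc ` U) - {{}})" by (auto simp: Pow_insert)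
    also have "Pow (Suc ` U) = (`) Suc ` Pow U" by (simp add: image_Pow_surj)
    also have "(`) Suc ` Pow U - {{}} = ?E" by auto
    finally show ?thesis by (simp only: image_image)
  qed
  have "sum ?g ?C = sum ?g ?D + sum ?g ?E"
    unfolding C by (rule sum.union_disjoint) (use assms in auto)
  also have "sum ?g ?D = (\<Sum>B\<in>Pow U. (z * x) * (q * x) ^ card B)"
  proof (subst sum.reindex)
    show "inj_on (\<lambda>B. insert 0 (Suc ` B)) (Pow U)"
      by (rule inj_onI) (metis Diff_insert_absorb imageE inj_image_eq_iff inj_Suc nat.distinct(1))
    show "sum (?g \<circ> (\<lambda>B. insert 0 (Suc ` B))) (Pow U) = (\<Sum>B\<in>Pow U. (z * x) * (q * x) ^ card B)"
    proof (rule sum.cong[OF refl])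
      fix B assume B: "B \<in> Pow U"
      have "card (insert 0 (Suc ` B)) = Suc (card B)"
        using B fin by (subst card_insert_disjoint) (auto simp: card_image)
      then show "(?g \<circ> (\<lambda>B. insert 0 (Suc ` B))) B = (z * x) * (q * x) ^ card B"
        by (simp add: power_mult_distrib)
    qed
  qed
  also have "sum ?g ?E = (\<Sum>B\<in>Pow U - {{}}. q ^ (card B - 1) * x ^ card (B \<union> {i\<in>U. \<forall>b\<in>B. i \<le> b}))"
  proof (subst sum.reindex)
    show "inj_on ((`) Suc) (Pow U - {{}})"
      by (rule inj_onI) (simp add: inj_image_eq_iff)
    show "sum (?g \<circ> (`) Suc) (Pow U - {{}}) =
        (\<Sum>B\<in>Pow U - {{}}. q ^ (card B - 1) * x ^ card (B \<union> {i\<in>U. \<forall>b\<in>B. i \<le> b}))"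
      by (rule sum.cong[OF refl])
        (auto simp: card_image less_Suc_eq_le simp flip: image_Un)
  qed
  also have "(\<Sum>B\<in>Pow U. (z * x) * (q * x) ^ card B) = z * x * (1 + q * x) ^ card U"
    by (simp add: sum_Pow_power_card[OF assms] flip: sum_distrib_left)
  finally have "(1 + q * x - x) * sum ?g ?C = (1 + q * x - x) * (z * x * (1 + q * x) ^ card U) +
      x * ((1 + q * x) ^ card U - x ^ card U)"
    by (simp only: distrib_left[of "1 + q * x - x"] sum_nonempty_subsets[OF assms])
  then show ?thesis by (simp add: algebra_simps)
qed

lemma free_rows_poly_Suc:
  "(1 + var_q * x - x) * free_rows_poly (Suc n) x =
     x * ((1 + var_q * x - x) * (var_y\<^sup>2 * free_rows_poly n x + var_y * var_t * free_rows_poly n (1 + var_q * x)) +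
       free_rows_poly n (1 + var_q * x) - free_rows_poly n x)"
proof -
  let ?c = "1 + var_q * x - x"
  let ?f = "\<lambda>(F, X). weight (F, X) * x ^ card (free_rows F X)"
  have fin: "finite (columns p)" for p
    using finite_free_rows by (cases p) (auto simp: columns_def)
  have "free_rows_poly (Suc n) x = sum ?f (add_row ` tableaux n) + sum ?f (add_col ` Sigma (tableaux n) columns)"
    unfolding free_rows_poly_def tableaux_Suc using fin
    by (intro sum.union_disjoint finite_imageI finite_SigmaI finite_tableaux)
      (auto simp: add_row_neq_add_col[symmetric])
  also have "sum ?f (add_row ` tableaux n) = x * var_y\<^sup>2 * free_rows_poly n x"
  proof -
    have "sum ?f (add_row ` tableaux n) = (\<Sum>p\<in>tableaux n. ?f (add_row p))"
      by (subst sum.reindex) (auto intro: inj_on_subset[OF inj_add_row])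
    also have "\<dots> = (\<Sum>p\<in>tableaux n. x * var_y\<^sup>2 * ?f p)"
    proof (rule sum.cong[OF refl])
      fix p :: "diagram \<times> (nat \<times> nat) set"
      obtain F X F' X' where p: "p = (F, X)" and a: "add_row (F, X) = (F', X')"
        by (metis surj_pair)
      have "weight (F', X') = var_y\<^sup>2 * weight (F, X)" using weight_add_row[of F X] a by simp
      then show "?f (add_row p) = x * var_y\<^sup>2 * ?f p"
        by (simp add: p a card_free_rows_add_row[OF a])
    qed
    finally show ?thesis by (simp add: free_rows_poly_def sum_distrib_left)
  qed
  also have "sum ?f (add_col ` Sigma (tableaux n) columns) =
      (\<Sum>p\<in>tableaux n. \<Sum>A\<in>columns p. ?f (add_col (p, A)))"
    by (subst sum.reindex) (auto intro: inj_on_subset[OF inj_add_col]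
      simp: sum.Sigma finite_tableaux fin)
  finally have "?c * free_rows_poly (Suc n) x = ?c * (x * var_y\<^sup>2 * free_rows_poly n x) +
      (\<Sum>p\<in>tableaux n. ?c * (\<Sum>A\<in>columns p. ?f (add_col (p, A))))"
    by (simp add: distrib_left sum_distrib_left)
  also have "(\<Sum>p\<in>tableaux n. ?c * (\<Sum>A\<in>columns p. ?f (add_col (p, A)))) =
      (\<Sum>(F, X)\<in>tableaux n. weight (F, X) * (x * (?c * (var_y * var_t) * (1 + var_q * x) ^ card (free_rows F X)
        + (1 + var_q * x) ^ card (free_rows F X) - x ^ card (free_rows F X))))"
  proof (rule sum.cong[OF refl])
    fix p assume p: "p \<in> tableaux n"
    obtain F X where e: "p = (F, X)" by (cases p)
    have finX: "finite X"
      using p finite_subset[OF _ finite_cells] by (auto simp: e tableaux_def tableau_ones_def)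
    let ?U = "free_rows F X"
    have "(\<Sum>A\<in>columns p. ?f (add_col (p, A))) = weight (F, X) *
       (\<Sum>A | A \<noteq> {} \<and> A \<subseteq> insert 0 (Suc ` ?U). (if 0 \<in> A then var_y * var_t else 1) *
         var_q ^ (card A - 1) * x ^ card (A \<union> Suc ` {i\<in>?U. \<forall>a\<in>A. i < a}))"
      unfolding sum_distrib_left
    proof (rule sum.cong)
      show "columns p = {A. A \<noteq> {} \<and> A \<subseteq> insert 0 (Suc ` ?U)}" by (simp add: e columns_def)
      fix A assume A: "A \<in> {A. A \<noteq> {} \<and> A \<subseteq> insert 0 (Suc ` ?U)}"
      then have "finite A" using finite_free_rows finite_subset by (metis finite_imageI finite_insert mem_Collect_eq)
      with A show "?f (add_col (p, A)) = weight (F, X) * ((if 0 \<in> A then var_y * var_t else 1) *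
         var_q ^ (card A - 1) * x ^ card (A \<union> Suc ` {i\<in>?U. \<forall>a\<in>A. i < a}))"
        by (simp add: e add_col_def weight_add_col finX free_rows_add_col mult.assoc)
    qed
    then show "?c * (\<Sum>A\<in>columns p. ?f (add_col (p, A))) =
      (case p of (F, X) \<Rightarrow> weight (F, X) * (x * (?c * (var_y * var_t) * (1 + var_q * x) ^ card (free_rows F X)
        + (1 + var_q * x) ^ card (free_rows F X) - x ^ card (free_rows F X))))"
      using sum_columns[OF finite_free_rows, of var_q x "var_y * var_t" F X]
      by (simp only: e prod.case mult.left_commute[of ?c])
  qed
  \<comment> \<open>Summed over all tableaux, the powers of 1 + qx with exponent the number of free
    rows form the same generating function at the argument 1 + qx.\<close>
  also have "\<dots> = x * (?c * (var_y * var_t) * free_rows_poly n (1 + var_q * x) + free_rows_poly n (1 + var_q * x) - free_rows_poly n x)"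
    unfolding free_rows_poly_def sum_distrib_left sum.distrib[symmetric] sum_subtractf[symmetric]
    by (intro sum.cong refl) (auto simp: algebra_simps)
  finally show ?thesis by (simp add: algebra_simps)
qed

lemma free_rows_poly_0: "free_rows_poly 0 x = 1"
proof -
  have "tableaux 0 = {(Diagram 0 [], {})}"
  proof (intro set_eqI iffI)
    fix p assume p: "p \<in> tableaux 0"
    obtain k ls X where e: "p = (Diagram k ls, X)" by (metis surj_pair diagram.exhaust)
    with p show "p \<in> {(Diagram 0 [], {})}"
      by (auto simp: tableaux_def diagram_length_def nrows_def tableau_ones_def cells_def shifted_row_lengths_def)
  qed (auto simp: tableaux_def diagram_length_def nrows_def tableau_ones_def ferrers_def blocked_def
      cells_def shifted_row_lengths_def)
  then show ?thesis
    by (simp add: free_rows_poly_def weight_def nrows_def so_set_def free_rows_def diagram_length_def)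
qed

section \<open>The q-difference equation\<close>

definition q_num :: "nat \<Rightarrow> int poly poly poly" where
  "q_num m = [:q_int m:]"

text \<open>Solved for the power of q, so that later computations can eliminate it in favour of
  [m].\<close>

lemma q_num_rec: "var_q ^ m = 1 - (1 - var_q) * q_num m"
proof -
  have "[:1 - a:] = 1 - [:a:]" for a :: "int poly poly"
    by (simp add: one_pCons)
  then have "[:1 - [:0, 1:] ^ m:] = 1 - var_q ^ m"
    by (simp only: var_q_def poly_const_pow)
  moreover have "[:q_int m * (1 - [:0, 1:]):] = q_num m * (1 - var_q)"
    by (simp add: var_q_def q_num_def one_pCons)
  ultimately have "q_num m * (1 - var_q) = 1 - var_q ^ m" by (simp only: q_int_eq)
  then show ?thesis by (simp add: algebra_simps)
qed

lemma var_q_neq: "var_q \<noteq> 1" "var_q \<noteq> 0"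
  by (auto simp: var_q_def one_pCons)

text \<open>Thus the substitution of 1 + qx for x becomes the shift from m to m + 1.\<close>

lemma q_num_Suc: "q_num (Suc m) = 1 + var_q * q_num m"
proof -
  have "(1 - var_q) * q_num (Suc m) = 1 - var_q * var_q ^ m"
    using q_num_rec[of "Suc m"] by simp
  also have "\<dots> = (1 - var_q) * (1 + var_q * q_num m)"
    unfolding q_num_rec[of m] by (simp add: algebra_simps)
  finally show ?thesis using var_q_neq by simp
qed

lemma q_num_1: "q_num 1 = 1"
  using q_num_Suc[of 0] by (simp add: q_num_def q_int_0)

lemma q_deriv_const_mult: "q_deriv ([:c:] * p) = [:c:] * q_deriv p"
  by (simp add: q_deriv_smult)

lemma q_deriv_var_y_mult: "q_deriv (var_y * p) = var_y * q_deriv p"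
  unfolding var_y_def by (rule q_deriv_const_mult)

lemma q_deriv_q_num_mult: "q_deriv (q_num m * p) = q_num m * q_deriv p"
  unfolding q_num_def by (rule q_deriv_const_mult)

lemma q_deriv_var_q_power_mult: "q_deriv (var_q ^ m * p) = var_q ^ m * q_deriv p"
  unfolding var_q_def poly_const_pow by (rule q_deriv_const_mult)

text \<open>The q-Leibniz rule for the factor t; on coefficients it is [k + 1] = 1 + q[k].\<close>

lemma q_deriv_var_t_mult: "q_deriv (var_t * p) = p + var_q * (var_t * q_deriv p)"
proof (rule poly_eqI)
  fix m
  have q: "q_int (Suc k) = 1 + [:0, 1:] * q_int k" for k
    using q_num_Suc[of k] by (simp add: q_num_def var_q_def one_pCons)
  show "coeff (q_deriv (var_t * p)) m = coeff (p + var_q * (var_t * q_deriv p)) m"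
  proof (cases m)
    case 0
    then show ?thesis by (simp add: var_t_def var_q_def coeff_q_deriv q[of 0] q_int_0)
  next
    case (Suc k)
    then show ?thesis
      by (simp add: var_t_def var_q_def coeff_q_deriv q[of "Suc k"] algebra_simps)
  qed
qed

lemmas q_deriv_rules = q_deriv_add q_deriv_var_y_mult q_deriv_q_num_mult q_deriv_var_q_power_mult
  q_deriv_var_t_mult

text \<open>The difference equation removes the value at [m + 1] from the recursion, and then q^m
  cancels. It is an assumption here because the induction that proves it uses this lemma with its
  own hypothesis, at both m and m + 1.\<close>

lemma free_rows_poly_Suc_q_num:
  assumes "q_num m * (free_rows_poly n (q_num (Suc m)) - free_rows_poly n (q_num m)) =
    var_q ^ m * ((var_y + var_t) * q_deriv (free_rows_poly n (q_num m)))"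
  shows "free_rows_poly (Suc n) (q_num m) = (var_y + var_t) * (q_num m * (var_y * free_rows_poly n (q_num m)) +
    (1 + var_y * var_t * var_q ^ m) * q_deriv (free_rows_poly n (q_num m)))"
proof -
  let ?s = "q_num m" and ?Q = "var_q ^ m"
  let ?f = "free_rows_poly n ?s" and ?g = "free_rows_poly n (q_num (Suc m))"
  have "1 + var_q * ?s - ?s = ?Q"
    by (simp add: q_num_rec algebra_simps)
  then have "?Q * free_rows_poly (Suc n) ?s = ?s * (?Q * (var_y\<^sup>2 * ?f + var_y * var_t * ?g) + ?g - ?f)"
    using free_rows_poly_Suc[of ?s n] by (simp add: q_num_Suc)
  \<comment> \<open>Regrouped so that the values at [m + 1] occur only in the difference to which
    the assumption applies.\<close>
  also have "\<dots> = ?Q * (?s * (var_y\<^sup>2 + var_y * var_t) * ?f) +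
      (?Q * var_y * var_t + 1) * (?s * (?g - ?f))"
    by (simp add: algebra_simps)
  also have "\<dots> = ?Q * ((var_y + var_t) * (?s * (var_y * ?f) +
      (1 + var_y * var_t * ?Q) * q_deriv ?f))"
    unfolding assms by (simp add: algebra_simps power2_eq_square)
  finally show ?thesis using var_q_neq by simp
qed

lemma free_rows_poly_q_num_diff:
  "q_num m * (free_rows_poly n (q_num (Suc m)) - free_rows_poly n (q_num m)) =
    var_q ^ m * ((var_y + var_t) * q_deriv (free_rows_poly n (q_num m)))"
proof (induction n arbitrary: m)
  case 0
  have "q_deriv 1 = 0"
    using q_deriv_power[of 0] by (simp add: q_int_0)
  then show ?case by (simp add: free_rows_poly_0)
next
  case (Suc n)
  define s Q where "s = q_num m" and "Q = var_q ^ m"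
  define f g where "f = free_rows_poly n s" and "g = free_rows_poly n (q_num (Suc m))"
  define f1 f2 where "f1 = q_deriv f" and "f2 = q_deriv f1"
  have Q: "Q = 1 - (1 - var_q) * s" unfolding Q_def s_def by (rule q_num_rec)
  have g: "s * g = s * f + Q * (var_y * f1 + var_t * f1)"
    using Suc.IH[of m] by (simp add: s_def Q_def f_def g_def f1_def algebra_simps)
  \<comment> \<open>Applying D to the difference equation for n yields \<open>s\<close> times the
    derivative of \<open>g\<close>, as \<open>s\<close> is constant in t.\<close>
  have "q_deriv (s * g) = s * f1 + Q * (var_y * f2 + (f1 + var_q * (var_t * f2)))"
    unfolding g by (simp only: q_deriv_rules s_def Q_def f2_def f1_def)
  then have g1: "s * q_deriv g = s * f1 + Q * (var_y * f2 + (f1 + var_q * (var_t * f2)))"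
    by (simp add: s_def q_deriv_rules)
  have next_m: "free_rows_poly (Suc n) s = (var_y + var_t) * (s * (var_y * f) + (1 + var_y * var_t * Q) * f1)"
    using free_rows_poly_Suc_q_num[OF Suc.IH[of m]] by (simp add: s_def Q_def f_def f1_def)
  have next_Suc_m: "free_rows_poly (Suc n) (q_num (Suc m)) = (var_y + var_t) *
      ((1 + var_q * s) * (var_y * g) + (1 + var_y * var_t * (var_q * Q)) * q_deriv g)"
    using free_rows_poly_Suc_q_num[OF Suc.IH[of "Suc m"]] by (simp add: s_def Q_def g_def q_num_Suc)
  \<comment> \<open>Bracketed so that the rules for D strip one factor at a time.\<close>
  let ?h = "s * (var_y * f) + (f1 + Q * (var_y * (var_t * f1)))"
  let ?h1 = "s * (var_y * f1) + (f2 + Q * (var_y * (f1 + var_q * (var_t * f2))))"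
  have h1: "q_deriv ?h = ?h1"
    by (simp only: q_deriv_rules s_def Q_def f2_def f1_def)
  have "free_rows_poly (Suc n) s = var_y * ?h + var_t * ?h"
    unfolding next_m by (simp add: algebra_simps)
  then have D: "q_deriv (free_rows_poly (Suc n) s) = var_y * ?h1 + (?h + var_q * (var_t * ?h1))"
    by (simp only: q_deriv_add[of "var_y * ?h"] q_deriv_var_y_mult[of ?h] q_deriv_var_t_mult[of ?h] h1)
  \<comment> \<open>After multiplication by \<open>s\<close>, both \<open>g\<close> and its
    derivative occur only with a factor \<open>s\<close> and can be replaced by \<open>g\<close> and
    \<open>g1\<close>.\<close>
  have "s * free_rows_poly (Suc n) (q_num (Suc m)) = (var_y + var_t) *
      ((1 + var_q * s) * (var_y * (s * g)) + (1 + var_y * var_t * (var_q * Q)) * (s * q_deriv g))"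
    unfolding next_Suc_m by (simp add: algebra_simps)
  then have "s * (free_rows_poly (Suc n) (q_num (Suc m)) - free_rows_poly (Suc n) s) = (var_y + var_t) *
      ((1 + var_q * s) * (var_y * (s * g)) + (1 + var_y * var_t * (var_q * Q)) * (s * q_deriv g)) -
      s * free_rows_poly (Suc n) s"
    by (simp add: algebra_simps)
  also have "\<dots> = Q * ((var_y + var_t) * q_deriv (free_rows_poly (Suc n) s))"
    \<comment> \<open>Both sides are now polynomials in y, t, q, \<open>s\<close>, \<open>f\<close>,
      \<open>f1\<close> and \<open>f2\<close>, and they agree as such.\<close>
    unfolding D unfolding g g1 next_m unfolding Q by (simp add: algebra_simps)
  finally show ?case unfolding s_def Q_def .
qed

theorem theorem1p7:
  shows "B_poly 0 = 1 \<and>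
    (\<forall>n. B_poly (Suc n) = (var_y + var_t) * q_deriv ((1 + var_y * var_t) * B_poly n))"
proof (intro conjI allI)
  show "B_poly 0 = 1" by (simp add: B_poly_eq_free_rows_poly free_rows_poly_0)
  fix n
  have "B_poly (Suc n) = (var_y + var_t) * (var_y * B_poly n +
      (1 + var_y * var_t * var_q) * q_deriv (B_poly n))"
    \<comment> \<open>The case m = 1, where the argument [1] = 1 ignores the distinction between
      free and other rows.\<close>
    using free_rows_poly_Suc_q_num[OF free_rows_poly_q_num_diff[of 1 n]] by (simp add: B_poly_eq_free_rows_poly q_num_1[simplified])
  also have "(1 + var_y * var_t) * B_poly n = B_poly n + var_y * (var_t * B_poly n)"
    by (simp add: algebra_simps)
  \<comment> \<open>By the q-Leibniz rule, D(ytB) = y(B + qt DB).\<close>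
  then have "var_y * B_poly n + (1 + var_y * var_t * var_q) * q_deriv (B_poly n) =
      q_deriv ((1 + var_y * var_t) * B_poly n)"
    by (simp add: q_deriv_rules) (simp add: algebra_simps)
  finally show "B_poly (Suc n) = (var_y + var_t) * q_deriv ((1 + var_y * var_t) * B_poly n)" .
qed

end
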